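(* Let $n\ge2$ and let $L\in\mathbb{R}^{n\times n}$ be irreducible with zero column sums, spectral abscissa $0$ with $0$ a simple eigenvalue, and eventually exponentially positive, with stationary density $\boldsymbol p^\infty$ and spectral projector $\Pi$ for the eigenvalue $0$. Let $\delta=\min\{-\operatorname{Re}\lambda:\lambda\in\operatorname{spec}(L),\ \lambda\ne0\}>0$ be the spectral gap, let $R(s)=(s\mathcal I-L)^{-1}(\mathcal I-\Pi)$ for $s>0$, and let $$C_\star=\sup_{s\in(0,\delta/2]}\|R(s)\|_{\max}.$$ Then $C_\star<\infty$, and the sharp threshold $\gamma_0$ for entrywise positivity of the resolvent $(\mathcal I-\gamma L)^{-1}$ satisfies $$\gamma_0\ \le\ \max\Bigl\{\frac{2}{\delta},\ \frac{C_\star}{\min_k p^\infty_k}\Bigr\}.$$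
   Context: $\mathcal I$ is the identity matrix; $\|M\|_{\max}=\max_{i,j}|M_{ij}|$; matrix inequalities are entrywise. $L$ is eventually exponentially positive if there is $\tau_0\ge0$ such that $e^{tL}>0$ for all $t\ge\tau_0$. The spectral abscissa is the maximal real part of the eigenvalues. The stationary density $\boldsymbol p^\infty$ is the right null vector of $L$ normalized by $\sum_i p^\infty_i=1$ (it is entrywise positive), and $\Pi=\lim_{t\to\infty}e^{tL}$ is the spectral projector onto $\ker L$ along $\operatorname{ran}L$, with entries $\Pi_{ij}=p^\infty_i$. The sharp threshold is $\gamma_0=\inf\{g\ge0:(\mathcal I-\gamma L)^{-1}>0\text{ for all }\gamma>g\}$. *)

theory Defs
  imports "HOL-Analysis.Analysis" "HOL-Computational_Algebra.Polynomial"
begin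

definition entrywise_pos :: "real^'n^'n \<Rightarrow> bool" where
  "entrywise_pos M \<longleftrightarrow> (\<forall>i j. 0 < M $ i $ j)"

definition max_norm :: "real^'n^'n \<Rightarrow> real" where
  "max_norm M = Max {\<bar>M $ i $ j\<bar> | i j. True}"

text \<open>The type class multiplication and powers on \<open>vec\<close> are componentwise, so matrix powers
  and the exponential series are spelled out with respect to the matrix product.\<close>

primrec mat_power :: "real^'n^'n \<Rightarrow> nat \<Rightarrow> real^'n^'n" where
  "mat_power A 0 = mat 1"
| "mat_power A (Suc k) = A ** mat_power A k"

definition mat_exp :: "real^'n^'n \<Rightarrow> real^'n^'n" where
  "mat_exp A = (\<Sum>k. (1 / fact k) *\<^sub>R mat_power A k)"

definition eventually_exp_pos :: "real^'n^'n \<Rightarrow> bool" where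
  "eventually_exp_pos L \<longleftrightarrow> (\<exists>\<tau>0\<ge>0. \<forall>t\<ge>\<tau>0. entrywise_pos (mat_exp (t *\<^sub>R L)))"

text \<open>Irreducibility: no simultaneous permutation of rows and columns brings the matrix to block
  triangular form with nontrivial blocks; \<open>S\<close> is the index set of one of the two diagonal blocks.\<close>

definition irreducible_matrix :: "real^'n^'n \<Rightarrow> bool" where
  "irreducible_matrix L \<longleftrightarrow>
     \<not> (\<exists>S. S \<noteq> {} \<and> S \<noteq> UNIV \<and> (\<forall>i\<in>S. \<forall>j\<in>-S. L $ i $ j = 0))"

abbreviation complexify :: "real^'n^'n \<Rightarrow> complex^'n^'n" where
  "complexify \<equiv> map_matrix complex_of_real"

definition spec :: "real^'n^'n \<Rightarrow> complex set" where
  "spec L = {z. \<exists>v. v \<noteq> 0 \<and> complexify L *v v = z *s v}"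

definition charpoly :: "'a::comm_ring_1^'n^'n \<Rightarrow> 'a poly" where
  "charpoly A = det (\<chi> i j. (if i = j then [:0, 1:] else 0) - [:A $ i $ j:])"

definition simple_eigenvalue :: "real^'n^'n \<Rightarrow> complex \<Rightarrow> bool" where
  "simple_eigenvalue L z \<longleftrightarrow> z \<in> spec L \<and> order z (charpoly (complexify L)) = 1"

definition spectral_abscissa :: "real^'n^'n \<Rightarrow> real" where
  "spectral_abscissa L = Max (Re ` spec L)"

definition spectral_gap :: "real^'n^'n \<Rightarrow> real" where
  "spectral_gap L = Min {- Re z | z. z \<in> spec L \<and> z \<noteq> 0}"

definition stationary_density :: "real^'n^'n \<Rightarrow> real^'n \<Rightarrow> bool" where
  "stationary_density L p \<longleftrightarrow> L *v p = 0 \<and> (\<Sum>i\<in>UNIV. p $ i) = 1"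

text \<open>For a simple eigenvalue \<open>0\<close>, its spectral projector is the projector onto the kernel
  along the range.\<close>

definition spectral_projector_zero :: "real^'n^'n \<Rightarrow> real^'n^'n \<Rightarrow> bool" where
  "spectral_projector_zero L P \<longleftrightarrow>
     P ** P = P \<and> range ((*v) P) = {v. L *v v = 0} \<and> {v. P *v v = 0} = range ((*v) L)"

text \<open>\<^const>\<open>matrix_inv\<close> is unspecified on singular matrices, hence the explicit
  invertibility.  The infimum is taken in the extended reals: it is \<open>\<infinity>\<close> if no \<open>g\<close> qualifies.\<close>

definition positivity_threshold :: "real^'n^'n \<Rightarrow> ereal" where
  "positivity_threshold L =
     Inf (ereal ` {g. 0 \<le> g \<and> (\<forall>\<gamma>>g. invertible (mat 1 - \<gamma> *\<^sub>R L) \<and>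
                                       entrywise_pos (matrix_inv (mat 1 - \<gamma> *\<^sub>R L)))})"

definition reduced_resolvent :: "real^'n^'n \<Rightarrow> real^'n^'n \<Rightarrow> real \<Rightarrow> real^'n^'n" where
  "reduced_resolvent L P s = matrix_inv (mat s - L) ** (mat 1 - P)"

end

theory Submission
  imports Defs "HOL-Computational_Algebra.Fundamental_Theorem_Algebra"
begin

text \<open>For some \<open>t > 0\<close> the matrix \<open>e\<^sup>t\<^sup>L\<close> is entrywise positive with unit column sums, hence a strict
  \<open>l\<^sup>1\<close>-contraction on the sum-zero vectors.  Every eigenvector for a nonzero eigenvalue of \<open>L\<close> is
  sum-zero, so these eigenvalues have negative real part; likewise \<open>p > 0\<close>, the kernel of \<open>L\<close> is
  spanned by \<open>p\<close>, and \<open>P\<^sub>i\<^sub>j = p\<^sub>i\<close>.  The range of \<open>R(s)\<close> is sum-zero, and there \<open>s - L\<close> is bounded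
  below uniformly for \<open>s\<close> in the compact interval \<open>[0, \<delta>/2]\<close>, so \<open>C\<close> is finite.  Finally
  \<open>(1 - \<gamma>L)\<^sup>-\<^sup>1 = P + s R(s)\<close> for \<open>s = 1/\<gamma>\<close>, whose entries are at least \<open>min p - s C\<close>.\<close>

section \<open>The characteristic polynomial\<close>

text \<open>In the Leibniz expansion only the identity permutation contributes to the coefficient of
  degree n. This gives both that the characteristic polynomial is nonzero, hence finiteness of the
  spectrum, and that its degree is at least n.\<close>

lemma coeff_charpoly_card:
  fixes A :: "'a::idom^'n^'n"
  shows "coeff (charpoly A) CARD('n) = 1"
proof -
  let ?M = "(\<chi> i j. (if i = j then [:0, 1:] else 0) - [:A $ i $ j:]) :: 'a poly^'n^'n"
  let ?t = "\<lambda>\<sigma>. coeff (of_int (sign \<sigma>) * (\<Prod>i\<in>UNIV. ?M $ i $ \<sigma> i)) CARD('n)"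
  have "?t \<sigma> = (if \<sigma> = id then 1 else 0)" if "\<sigma> permutes UNIV" for \<sigma> :: "'n \<Rightarrow> 'n"
  proof (cases "\<sigma> = id")
    case True
    have "degree (\<Prod>i\<in>UNIV. ?M $ i $ i) = (\<Sum>i::'n\<in>UNIV. degree (?M $ i $ i))"
      by (rule degree_prod_sum_eq) simp
    then have "degree (\<Prod>i\<in>UNIV. ?M $ i $ i) = CARD('n)"
      by simp
    moreover have "lead_coeff (\<Prod>i\<in>UNIV. ?M $ i $ i) = 1"
      by (simp add: lead_coeff_prod)
    ultimately show ?thesis
      using True by (simp add: sign_id)
  next
    case False
    then obtain k where k: "\<sigma> k \<noteq> k"
      by (metis eq_id_iff)
    have "degree (\<Prod>i\<in>UNIV. ?M $ i $ \<sigma> i) \<le> (\<Sum>i\<in>UNIV. degree (?M $ i $ \<sigma> i))"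
      using degree_prod_sum_le[of UNIV "\<lambda>i. ?M $ i $ \<sigma> i"] by (simp add: o_def)
    \<comment> \<open>The factor at the moved index \<open>k\<close> is off the diagonal and
      therefore constant; every other factor has degree at most 1.\<close>
    also have "\<dots> \<le> (\<Sum>i\<in>UNIV. if i = k then 0 else 1)"
      using k by (intro sum_mono) auto
    also have "\<dots> = card (UNIV - {k})"
      by (simp add: if_distrib sum.If_cases Compl_eq_Diff_UNIV)
    also have "\<dots> < CARD('n)"
      by (rule card_Diff1_less) auto
    finally have "degree (\<Prod>i\<in>UNIV. ?M $ i $ \<sigma> i) < CARD('n)" .
    moreover have "degree (of_int (sign \<sigma>) * q) \<le> degree q" for q :: "'a poly"
      by (simp add: of_int_poly)
    ultimately show ?thesis
      using False by (metis (no_types, lifting) coeff_eq_0 le_less_trans)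
  qed
  then have "coeff (charpoly A) CARD('n) = (\<Sum>\<sigma> | \<sigma> permutes (UNIV :: 'n set). if \<sigma> = id then 1 else 0)"
    unfolding charpoly_def det_def coeff_sum by (intro sum.cong) auto
  also have "\<dots> = 1"
    by (simp add: permutes_id)
  finally show ?thesis .
qed

lemma poly_charpoly: "poly (charpoly A) z = det (mat z - A)"
  by (auto simp: charpoly_def det_def poly_sum poly_prod mat_def of_int_poly intro!: sum.cong prod.cong arg_cong2[where f = "(*)"])

lemma mat_diff_mult_vec: "(mat z - A) *v v = z *s v - A *v v" for A :: "'a::comm_ring_1^'n^'n"
  by (simp add: vec_eq_iff mat_def matrix_vector_mult_def left_diff_distrib sum_subtractf
      if_distrib[of "\<lambda>x. x * _"] cong: if_cong)

lemma spec_eq_roots: "spec L = {z. poly (charpoly (complexify L)) z = 0}"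
proof -
  have "z \<in> spec L \<longleftrightarrow> \<not> invertible (mat z - complexify L)" for z
    unfolding invertible_left_inverse matrix_left_invertible_ker spec_def mat_diff_mult_vec
    by (auto simp: eq_commute[of "z *s _"])
  then show ?thesis
    by (auto simp: poly_charpoly invertible_det_nz)
qed

lemma charpoly_nonzero: "charpoly A \<noteq> 0" for A :: "'a::idom^'n^'n"
  using coeff_charpoly_card[of A] by auto

lemma finite_spec: "finite (spec L)"
  unfolding spec_eq_roots by (rule poly_roots_finite) (rule charpoly_nonzero)

text \<open>Dividing out the single factor at \<open>z\<close> leaves a cofactor of positive degree,
  since n is at least 2; its complex root cannot be \<open>z\<close>. This ensures that the minimum
  defining the spectral gap is over a nonempty set.\<close>

lemma simple_eigenvalue_not_only:
  fixes L :: "real^'n^'n"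
  assumes "simple_eigenvalue L z" "CARD('n) \<ge> 2"
  obtains w where "w \<in> spec L" "w \<noteq> z"
proof -
  let ?q = "charpoly (complexify L)"
  have q: "?q \<noteq> 0" "order z ?q = 1"
    using assms charpoly_nonzero by (auto simp: simple_eigenvalue_def)
  obtain r where r: "?q = [:- z, 1:] * r" "\<not> [:- z, 1:] dvd r"
    using order_decomp[OF q(1), of z] q(2) by auto
  have "CARD('n) \<le> degree ?q"
    by (rule le_degree) (simp add: coeff_charpoly_card)
  moreover have "r \<noteq> 0"
    using r q by auto
  moreover from this have "degree ?q = 1 + degree r"
    unfolding r(1) by (subst degree_mult_eq) auto
  ultimately have "degree r \<noteq> 0"
    using assms(2) by linarith
  then obtain w where "poly r w = 0"
    using fundamental_theorem_of_algebra[of r] by (auto simp: constant_degree)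
  then show thesis
    using r that[of w] by (auto simp: spec_eq_roots poly_eq_0_iff_dvd)
qed

section \<open>The matrix exponential\<close>

text \<open>The sum of all absolute entries dominates every absolute row sum, so each further factor
  costs at most this constant. The geometric bound is what the exponential series is compared
  with.\<close>

lemma mat_power_entry_bound:
  "\<bar>mat_power A k $ i $ j\<bar> \<le> (\<Sum>i\<in>UNIV. \<Sum>l\<in>UNIV. \<bar>A $ i $ l\<bar>) ^ k"
proof (induction k arbitrary: i)
  case 0
  then show ?case by (simp add: mat_def)
next
  case (Suc k)
  let ?K = "\<Sum>i\<in>UNIV. \<Sum>l\<in>UNIV. \<bar>A $ i $ l\<bar>"
  have "\<bar>mat_power A (Suc k) $ i $ j\<bar> \<le> (\<Sum>l\<in>UNIV. \<bar>A $ i $ l\<bar> * \<bar>mat_power A k $ l $ j\<bar>)"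
    by (simp add: matrix_matrix_mult_def) (metis (no_types, lifting) abs_mult sum.cong sum_abs)
  also have "\<dots> \<le> (\<Sum>l\<in>UNIV. \<bar>A $ i $ l\<bar>) * ?K ^ k"
    unfolding sum_distrib_right by (intro sum_mono mult_left_mono Suc.IH) auto
  also have "\<dots> \<le> ?K * ?K ^ k"
    by (intro mult_right_mono member_le_sum[of i UNIV "\<lambda>i. \<Sum>l\<in>UNIV. \<bar>A $ i $ l\<bar>"])
      (auto intro!: sum_nonneg zero_le_power)
  finally show ?case by simp
qed

text \<open>Convergence must be shown before the infinite sum in \<open>mat_exp\<close> means
  anything: the norms are dominated by a multiple of a scalar exponential series. Passing to entries
  lets later arguments use scalar series only.\<close>

lemma mat_exp_sums_entry:
  fixes A :: "real^'n^'n"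
  shows "(\<lambda>k. 1 / fact k * mat_power A k $ i $ j) sums (mat_exp A $ i $ j)"
proof -
  let ?K = "\<Sum>i\<in>UNIV. \<Sum>l\<in>UNIV. \<bar>A $ i $ l\<bar>"
  let ?c = "real CARD('n) * real CARD('n)"
  let ?f = "\<lambda>k. (1 / fact k) *\<^sub>R mat_power A k"
  have "norm (mat_power A k) \<le> ?c * ?K ^ k" for k
  proof -
    have "norm (mat_power A k) \<le> (\<Sum>i\<in>UNIV. norm (mat_power A k $ i))"
      by (simp add: norm_vec_def L2_set_le_sum)
    also have "\<dots> \<le> (\<Sum>i::'n\<in>UNIV. \<Sum>j::'n\<in>UNIV. ?K ^ k)"
      by (intro sum_mono order_trans[OF norm_le_l1_cart] mat_power_entry_bound)
    finally show ?thesis by simp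
  qed
  from divide_right_mono[OF this, of "fact _"]
  have bound: "norm (?f k) \<le> ?c * (?K ^ k /\<^sub>R fact k)" for k
    by (simp add: divide_inverse mult.commute mult.left_commute)
  have "summable (\<lambda>k. ?c * (?K ^ k /\<^sub>R fact k))"
    by (intro summable_mult summable_exp_generic)
  then have "summable ?f"
    by (rule summable_comparison_test'[where N = 0]) (rule bound)
  then have "?f sums mat_exp A"
    unfolding mat_exp_def by (rule summable_sums)
  moreover have "bounded_linear (\<lambda>M :: real^'n^'n. M $ i $ j)"
    by (rule bounded_linear_compose[OF bounded_linear_vec_nth bounded_linear_vec_nth])
  ultimately show ?thesis
    using bounded_linear.sums by fastforce
qed

text \<open>The k-th power acts on \<open>v\<close> as \<open>z ^ k\<close>, and the series is
  summed entry by entry. The setting is complex because a real matrix may have non-real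
  eigenvectors.\<close>

lemma complexify_mat_exp_eigenvector:
  fixes A :: "real^'n^'n"
  assumes "complexify A *v v = z *s v"
  shows "complexify (mat_exp A) *v v = exp z *s v"
proof -
  have pow: "complexify (mat_power A k) *v v = z ^ k *s v" for k
  proof (induction k)
    case 0
    have "complexify (mat 1) = (mat 1 :: complex^'n^'n)"
      by (simp add: vec_eq_iff mat_def)
    then show ?case by simp
  next
    case (Suc k)
    have "complexify (A ** B) = complexify A ** complexify B" for B
      by (simp add: vec_eq_iff matrix_matrix_mult_def)
    then show ?case
      using assms Suc by (simp add: vec.scale mult_ac flip: matrix_vector_mul_assoc)
  qed
  have "(complexify (mat_exp A) *v v) $ i = exp z * v $ i" for i
  proof -
    have "(\<lambda>k. \<Sum>j\<in>UNIV. complex_of_real (1 / fact k * mat_power A k $ i $ j) * v $ j)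
       sums (\<Sum>j\<in>UNIV. complex_of_real (mat_exp A $ i $ j) * v $ j)"
      by (intro sums_sum sums_mult2 sums_of_real mat_exp_sums_entry)
    moreover have "(\<Sum>j\<in>UNIV. complex_of_real (1 / fact k * mat_power A k $ i $ j) * v $ j)
       = z ^ k /\<^sub>R fact k * v $ i" for k
      using arg_cong[OF pow[of k], of "\<lambda>w. w $ i / fact k"]
      by (simp add: matrix_vector_mult_def sum_divide_distrib scaleR_conv_of_real field_simps)
    moreover have "(\<lambda>k. z ^ k /\<^sub>R fact k * v $ i) sums (exp z * v $ i)"
      by (intro sums_mult2 exp_converges)
    ultimately show ?thesis
      by (simp add: matrix_vector_mult_def sums_unique2)
  qed
  then show ?thesis
    by (simp add: vec_eq_iff)
qed

text \<open>All powers of \<open>A\<close> beyond the zeroth have zero column sums, so only the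
  identity term of the series contributes.\<close>

lemma mat_exp_column_sum:
  fixes A :: "real^'n^'n"
  assumes "\<And>j. (\<Sum>i\<in>UNIV. A $ i $ j) = 0"
  shows "(\<Sum>i\<in>UNIV. mat_exp A $ i $ j) = 1"
proof -
  have pow: "(\<Sum>i\<in>UNIV. mat_power A k $ i $ j) = (if k = 0 then 1 else 0)" for k
  proof (cases k)
    case (Suc m)
    have "(\<Sum>i\<in>UNIV. \<Sum>l\<in>UNIV. A $ i $ l * mat_power A m $ l $ j)
        = (\<Sum>l\<in>UNIV. (\<Sum>i\<in>UNIV. A $ i $ l) * mat_power A m $ l $ j)"
      unfolding sum_distrib_right by (rule sum.swap)
    then show ?thesis
      using Suc assms by (simp add: matrix_matrix_mult_def)
  qed (simp add: mat_def)
  have "(\<lambda>k. \<Sum>i\<in>UNIV. 1 / fact k * mat_power A k $ i $ j) sums (\<Sum>i\<in>UNIV. mat_exp A $ i $ j)"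
    by (intro sums_sum mat_exp_sums_entry)
  moreover have "(\<Sum>i\<in>UNIV. 1 / fact k * mat_power A k $ i $ j) = (if k = 0 then 1 else 0)" for k
    unfolding sum_distrib_left[symmetric] pow by simp
  moreover have "(\<lambda>k. if k = 0 then 1 else 0 :: real) sums 1"
    using sums_single[of 0 "\<lambda>_. 1 :: real"] by simp
  ultimately show ?thesis
    by (simp add: sums_unique2)
qed

section \<open>Positive column-stochastic matrices\<close>

text \<open>Doeblin's argument: with \<epsilon> the least entry of \<open>E\<close>, the contraction
  factor on sum-zero vectors is 1 - n \<epsilon>.\<close>

lemma stochastic_contraction:
  fixes E :: "real^'n^'n"
  assumes pos: "entrywise_pos E" and cols: "\<And>j. (\<Sum>i\<in>UNIV. E $ i $ j) = 1"
    and v: "(\<Sum>i\<in>UNIV. v $ i) = 0" "v \<noteq> 0"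
  shows "(\<Sum>i\<in>UNIV. cmod ((complexify E *v v) $ i)) < (\<Sum>i\<in>UNIV. cmod (v $ i))"
proof -
  define \<epsilon> where "\<epsilon> = Min (range (\<lambda>(i, j). E $ i $ j))"
  have "\<epsilon> \<in> range (\<lambda>(i, j). E $ i $ j)"
    unfolding \<epsilon>_def by (intro Min_in) auto
  then have "\<epsilon> > 0"
    using pos by (auto simp: entrywise_pos_def)
  have le: "\<epsilon> \<le> E $ i $ j" for i j
    unfolding \<epsilon>_def by (intro Min_le) (auto intro: image_eqI[of _ _ "(i, j)"])
  \<comment> \<open>On sum-zero vectors, subtracting the constant \<open>\<epsilon>\<close> from all entries does not change the image.\<close>
  have "cmod ((complexify E *v v) $ i) \<le> (\<Sum>j\<in>UNIV. (E $ i $ j - \<epsilon>) * cmod (v $ j))" for i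
  proof -
    have "(\<Sum>j\<in>UNIV. complex_of_real (E $ i $ j - \<epsilon>) * v $ j)
        = (complexify E *v v) $ i - \<epsilon> * (\<Sum>j\<in>UNIV. v $ j)"
      by (simp add: matrix_vector_mult_def left_diff_distrib sum_subtractf sum_distrib_left)
    then have "(complexify E *v v) $ i = (\<Sum>j\<in>UNIV. complex_of_real (E $ i $ j - \<epsilon>) * v $ j)"
      using v by simp
    also have "cmod \<dots> \<le> (\<Sum>j\<in>UNIV. cmod (complex_of_real (E $ i $ j - \<epsilon>) * v $ j))"
      by (rule norm_sum)
    also have "\<dots> = (\<Sum>j\<in>UNIV. (E $ i $ j - \<epsilon>) * cmod (v $ j))"
      using le unfolding norm_mult norm_of_real by (intro sum.cong) auto
    finally show ?thesis .
  qed
  then have "(\<Sum>i\<in>UNIV. cmod ((complexify E *v v) $ i))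
      \<le> (\<Sum>i\<in>UNIV. \<Sum>j\<in>UNIV. (E $ i $ j - \<epsilon>) * cmod (v $ j))"
    by (rule sum_mono)
  also have "\<dots> = (\<Sum>j\<in>UNIV. (\<Sum>i\<in>UNIV. E $ i $ j - \<epsilon>) * cmod (v $ j))"
    unfolding sum_distrib_right by (rule sum.swap)
  also have "\<dots> = (1 - real CARD('n) * \<epsilon>) * (\<Sum>j\<in>UNIV. cmod (v $ j))"
    by (simp add: sum_subtractf cols sum_distrib_left)
  also have "\<dots> < 1 * (\<Sum>j\<in>UNIV. cmod (v $ j))"
  proof (rule mult_strict_right_mono)
    show "1 - real CARD('n) * \<epsilon> < 1"
      using \<open>\<epsilon> > 0\<close> by simp
    obtain k where "v $ k \<noteq> 0"
      using v(2) by (auto simp: vec_eq_iff)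
    then show "0 < (\<Sum>j\<in>UNIV. cmod (v $ j))"
      by (intro sum_pos2[of _ k]) auto
  qed
  finally show ?thesis by simp
qed

lemma sum_mult_vec:
  "(\<Sum>i\<in>UNIV. (A *v x) $ i) = (\<Sum>j\<in>UNIV. (\<Sum>i\<in>UNIV. A $ i $ j) * x $ j)"
  unfolding matrix_vector_mult_def sum_distrib_right vec_lambda_beta by (rule sum.swap)

abbreviation complexify_vec :: "real^'n \<Rightarrow> complex^'n" where
  "complexify_vec x \<equiv> (\<chi> i. complex_of_real (x $ i))"

lemma complexify_mult_vec: "complexify A *v complexify_vec x = complexify_vec (A *v x)"
  by (simp add: vec_eq_iff matrix_vector_mult_def)

lemma stochastic_fixed_point_unique:
  fixes E :: "real^'n^'n"
  assumes pos: "entrywise_pos E" and cols: "\<And>j. (\<Sum>i\<in>UNIV. E $ i $ j) = 1"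
    and x: "E *v x = x" "(\<Sum>i\<in>UNIV. x $ i) = 0"
  shows "x = 0"
proof (rule ccontr)
  assume "x \<noteq> 0"
  then have "complexify_vec x \<noteq> 0"
    by (auto simp: vec_eq_iff)
  moreover have "(\<Sum>i\<in>UNIV. complexify_vec x $ i) = 0"
    using x(2) by (simp flip: of_real_sum)
  ultimately show False
    using stochastic_contraction[OF pos cols, of "complexify_vec x"] x(1)
    by (simp add: complexify_mult_vec)
qed

text \<open>A Perron-Frobenius argument: the vector \<open>q\<close> of absolute values is again
  fixed by \<open>E\<close>, so by uniqueness it is a multiple of \<open>p\<close>. This rules out
  negative entries, and positivity of \<open>E\<close> then rules out zeros.\<close>

lemma stochastic_fixed_point_pos:
  fixes E :: "real^'n^'n"
  assumes pos: "entrywise_pos E" and cols: "\<And>j. (\<Sum>i\<in>UNIV. E $ i $ j) = 1"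
    and p: "E *v p = p" "(\<Sum>i\<in>UNIV. p $ i) = 1"
  shows "p $ k > 0"
proof -
  define q where "q = (\<chi> i. \<bar>p $ i\<bar>)"
  have le: "q $ i \<le> (E *v q) $ i" for i
  proof -
    have "q $ i = \<bar>\<Sum>j\<in>UNIV. E $ i $ j * p $ j\<bar>"
      using p(1) by (simp add: q_def vec_eq_iff matrix_vector_mult_def)
    also have "\<dots> \<le> (\<Sum>j\<in>UNIV. \<bar>E $ i $ j * p $ j\<bar>)"
      by (rule sum_abs)
    also have "\<dots> = (E *v q) $ i"
      using pos by (simp add: q_def matrix_vector_mult_def abs_mult entrywise_pos_def less_imp_le)
    finally show ?thesis .
  qed
  \<comment> \<open>Unit column sums preserve the total, so the entrywise inequality
    \<open>le\<close> has no slack.\<close>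
  have "(\<Sum>i\<in>UNIV. (E *v q) $ i - q $ i) = 0"
    by (simp add: sum_subtractf sum_mult_vec cols)
  then have "E *v q = q"
    using le by (subst (asm) sum_nonneg_eq_0_iff) (auto simp: vec_eq_iff)
  moreover define c where "c = (\<Sum>i\<in>UNIV. q $ i)"
  ultimately have "E *v (q - c *\<^sub>R p) = q - c *\<^sub>R p"
    by (simp add: matrix_vector_mult_diff_distrib matrix_vector_mult_scaleR p)
  then have "q - c *\<^sub>R p = 0"
    by (rule stochastic_fixed_point_unique[OF pos cols])
      (simp add: sum_subtractf p c_def flip: sum_distrib_left)
  then have qp: "\<bar>p $ i\<bar> = c * p $ i" for i
    by (auto simp: vec_eq_iff q_def)
  have "(\<Sum>i\<in>UNIV. p $ i) \<le> c"
    unfolding c_def q_def by (intro sum_mono) auto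
  then have "c > 0"
    using p by simp
  then have nonneg: "p $ i \<ge> 0" for i
    using qp[of i] by (metis abs_ge_zero zero_le_mult_iff not_less)
  obtain l where "p $ l \<noteq> 0"
    using p(2) by (metis sum.neutral zero_neq_one)
  then have "p $ l > 0"
    using nonneg[of l] by simp
  then have "0 < (\<Sum>j\<in>UNIV. E $ k $ j * p $ j)"
    using pos nonneg by (intro sum_pos2[where i = l]) (simp_all add: entrywise_pos_def less_imp_le)
  then have "0 < (E *v p) $ k"
    by (simp add: matrix_vector_mult_def)
  then show ?thesis
    using p(1) by simp
qed

section \<open>Generators with eventually positive exponential\<close>

locale eventually_positive_generator =
  fixes L :: "real^'n^'n"
  assumes columns: "\<And>j. (\<Sum>i\<in>UNIV. L $ i $ j) = 0"
    and eventually_pos: "eventually_exp_pos L"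
begin

lemma positive_time:
  obtains t where "t > 0" "entrywise_pos (mat_exp (t *\<^sub>R L))"
    "\<And>j. (\<Sum>i\<in>UNIV. mat_exp (t *\<^sub>R L) $ i $ j) = 1"
proof -
  obtain \<tau> where "\<tau> \<ge> 0" "\<And>t. t \<ge> \<tau> \<Longrightarrow> entrywise_pos (mat_exp (t *\<^sub>R L))"
    using eventually_pos by (auto simp: eventually_exp_pos_def)
  moreover have "(\<Sum>i\<in>UNIV. mat_exp (t *\<^sub>R L) $ i $ j) = 1" for t j
    using columns by (intro mat_exp_column_sum) (simp flip: sum_distrib_left)
  \<comment> \<open>The threshold may be 0; adding 1 makes the time strictly positive, so that t *
    Re z has the sign of Re z.\<close>
  ultimately show thesis
    using that[of "\<tau> + 1"] by simp
qed

lemma complexify_scaleR_eigenvector: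
  "complexify L *v v = z *s v \<Longrightarrow> complexify (t *\<^sub>R L) *v v = (of_real t * z) *s v"
  by (simp add: vec_eq_iff matrix_vector_mult_def mult.assoc flip: sum_distrib_left)

text \<open>The vector is also an eigenvector of the positive stochastic matrix at time t, with
  eigenvalue exp(t z); strict contraction forces its modulus exp(t Re z) below 1.\<close>

lemma sum_zero_eigenvector_imp_stable:
  assumes v: "complexify L *v v = z *s v" "v \<noteq> 0" "(\<Sum>i\<in>UNIV. v $ i) = 0"
  shows "Re z < 0"
proof -
  obtain t where t: "t > 0" "entrywise_pos (mat_exp (t *\<^sub>R L))"
    "\<And>j. (\<Sum>i\<in>UNIV. mat_exp (t *\<^sub>R L) $ i $ j) = 1"
    using positive_time by metis
  have "complexify (mat_exp (t *\<^sub>R L)) *v v = exp (of_real t * z) *s v"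
    by (intro complexify_mat_exp_eigenvector complexify_scaleR_eigenvector v)
  then have "exp (t * Re z) * (\<Sum>i\<in>UNIV. cmod (v $ i)) < (\<Sum>i\<in>UNIV. cmod (v $ i))"
    using stochastic_contraction[OF t(2,3) v(3,2)] by (simp add: norm_mult sum_distrib_left)
  then have "exp (t * Re z) < 1"
    by (smt (verit) mult_le_cancel_right1 norm_ge_zero sum_nonneg)
  then show ?thesis
    using t(1) by (simp add: mult_less_0_iff)
qed

text \<open>Summing the entries of \<open>L v = z v\<close> gives 0 = z times the sum of
  \<open>v\<close>, so the eigenvector is sum-zero.\<close>

lemma nonzero_eigenvalue_stable:
  assumes "z \<in> spec L" "z \<noteq> 0"
  shows "Re z < 0"
proof -
  obtain v where v: "v \<noteq> 0" "complexify L *v v = z *s v"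
    using assms by (auto simp: spec_def)
  have "(\<Sum>i\<in>UNIV. (complexify L *v v) $ i) = 0"
    unfolding sum_mult_vec using columns by (simp flip: of_real_sum)
  then have "(\<Sum>i\<in>UNIV. v $ i) = 0"
    using v assms by (simp flip: sum_distrib_left)
  then show ?thesis
    using v sum_zero_eigenvector_imp_stable by blast
qed

lemma sum_generator: "(\<Sum>i\<in>UNIV. (L *v x) $ i) = 0"
  by (simp add: sum_mult_vec columns)

text \<open>A nonzero solution would be a sum-zero eigenvector with a nonnegative eigenvalue. The
  case s = 0 yields uniqueness of the stationary direction and closes the parameter interval in the
  compactness argument below.\<close>

lemma sum_zero_kernel:
  assumes "L *v x = s *s x" "s \<ge> 0" "(\<Sum>i\<in>UNIV. x $ i) = 0"
  shows "x = 0"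
proof (rule ccontr)
  assume "x \<noteq> 0"
  then have "complexify_vec x \<noteq> 0"
    by (auto simp: vec_eq_iff)
  moreover have "complexify L *v complexify_vec x = complex_of_real s *s complexify_vec x"
    unfolding complexify_mult_vec assms(1) by (simp add: vec_eq_iff)
  moreover have "(\<Sum>i\<in>UNIV. complexify_vec x $ i) = 0"
    using assms(3) by (simp flip: of_real_sum)
  ultimately show False
    using sum_zero_eigenvector_imp_stable[of "complexify_vec x" "of_real s"] assms(2) by auto
qed

lemma invertible_resolvent:
  assumes "s > 0"
  shows "invertible (mat s - L)"
  unfolding invertible_left_inverse matrix_left_invertible_ker mat_diff_mult_vec
proof (intro allI impI)
  fix x assume x: "s *s x - L *v x = 0"
  then have "(\<Sum>i\<in>UNIV. (s *s x) $ i) = 0"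
    using sum_generator by (metis eq_iff_diff_eq_0)
  then have "(\<Sum>i\<in>UNIV. x $ i) = 0"
    using assms by (simp flip: sum_distrib_left)
  then show "x = 0"
    using x assms by (intro sum_zero_kernel[of x s]) auto
qed

text \<open>On the compact set of parameters in [0, d] and sum-zero unit vectors, the continuous
  function \<open>f\<close> is positive and attains its minimum; homogeneity in \<open>y\<close>
  removes the normalization. Restricting to sum-zero vectors is what keeps the bound positive at s =
  0.\<close>

lemma resolvent_lower_bound:
  obtains m where "m > 0"
    "\<And>s y. 0 \<le> s \<Longrightarrow> s \<le> d \<Longrightarrow> (\<Sum>i\<in>UNIV. y $ i) = 0 \<Longrightarrow> m * norm y \<le> norm (s *\<^sub>R y - L *v y)"
proof -
  define K where "K = {0..d} \<times> (sphere 0 1 \<inter> {y :: real^'n. (\<Sum>i\<in>UNIV. y $ i) = 0})"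
  define f where "f = (\<lambda>(s, y). norm (s *\<^sub>R y - L *v y))"
  have "compact K"
    unfolding K_def
    by (intro compact_Times compact_Icc compact_Int_closed compact_sphere closed_Collect_eq
        continuous_intros)
  have "continuous_on K f"
    unfolding f_def case_prod_beta
    by (intro continuous_intros
        bounded_linear.continuous_on[OF matrix_vector_mul_bounded_linear])
  have f_pos: "f u > 0" if "u \<in> K" for u
    using that sum_zero_kernel[of "snd u" "fst u"]
    by (auto simp: K_def f_def scalar_mult_eq_scaleR)
  have "\<exists>m>0. \<forall>u\<in>K. m \<le> f u"
  \<comment> \<open>The set is empty, for example, when d is negative; any positive constant then
    serves.\<close>
  proof (cases "K = {}")
    case True
    then show ?thesis
      using zero_less_one by blast
  next
    case False
    then show ?thesis
      using continuous_attains_inf[OF \<open>compact K\<close> _ \<open>continuous_on K f\<close>] f_pos by meson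
  qed
  then obtain m where m: "m > 0" "\<And>u. u \<in> K \<Longrightarrow> m \<le> f u"
    by blast
  have "m * norm y \<le> norm (s *\<^sub>R y - L *v y)"
    if "0 \<le> s" "s \<le> d" "(\<Sum>i\<in>UNIV. y $ i) = 0" for s y
  proof (cases "y = 0")
    case False
    let ?w = "(1 / norm y) *\<^sub>R y"
    have "(s, ?w) \<in> K"
      using that False by (auto simp: K_def simp flip: sum_divide_distrib)
    then have "m \<le> norm (s *\<^sub>R ?w - L *v ?w)"
      using m(2)[of "(s, ?w)"] by (simp add: f_def)
    also have "s *\<^sub>R ?w - L *v ?w = (1 / norm y) *\<^sub>R (s *\<^sub>R y - L *v y)"
      unfolding matrix_vector_mult_scaleR scaleR_diff_right scaleR_left_commute[of s] ..
    also have "norm \<dots> = norm (s *\<^sub>R y - L *v y) / norm y"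
      unfolding norm_scaleR by simp
    finally show ?thesis
      using False by (simp add: field_simps)
  qed simp
  then show thesis
    using m(1) that by blast
qed

lemma mat_exp_fixes_kernel:
  assumes "L *v x = 0"
  shows "mat_exp (t *\<^sub>R L) *v x = x"
proof -
  have "complexify L *v complexify_vec x = 0 *s complexify_vec x"
    unfolding complexify_mult_vec assms by (simp add: vec_eq_iff)
  from complexify_mat_exp_eigenvector[OF complexify_scaleR_eigenvector[OF this, of t]]
  show ?thesis
    by (simp add: complexify_mult_vec vec_eq_iff)
qed

section \<open>The spectral projector and the reduced resolvent\<close>

context
  fixes p :: "real^'n"
  assumes stationary: "stationary_density L p"
begin

lemma stationary_density_pos: "p $ k > 0"
proof -
  obtain t where "entrywise_pos (mat_exp (t *\<^sub>R L))"
    "\<And>j. (\<Sum>i\<in>UNIV. mat_exp (t *\<^sub>R L) $ i $ j) = 1"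
    using positive_time by metis
  moreover have "mat_exp (t *\<^sub>R L) *v p = p" "(\<Sum>i\<in>UNIV. p $ i) = 1"
    using stationary mat_exp_fixes_kernel by (auto simp: stationary_density_def)
  ultimately show ?thesis
    by (rule stochastic_fixed_point_pos)
qed

text \<open>Subtracting the multiple of \<open>p\<close> with the same total leaves a sum-zero null
  vector, which vanishes.\<close>

lemma kernel_eq: "L *v x = 0 \<Longrightarrow> x = (\<Sum>i\<in>UNIV. x $ i) *\<^sub>R p"
  using sum_zero_kernel[of "x - (\<Sum>i\<in>UNIV. x $ i) *\<^sub>R p" 0] stationary
  by (simp add: stationary_density_def matrix_vector_mult_diff_distrib matrix_vector_mult_scaleR
      sum_subtractf flip: sum_distrib_left)

context
  fixes P :: "real^'n^'n"
  assumes projector: "spectral_projector_zero L P"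
begin

lemma generator_projector: "L *v (P *v x) = 0"
  using projector by (auto simp: spectral_projector_zero_def)

text \<open>The difference x - P x lies in the kernel of \<open>P\<close>, which is the range of
  \<open>L\<close>, and that range is sum-zero.\<close>

lemma sum_projector: "(\<Sum>i\<in>UNIV. (P *v x) $ i) = (\<Sum>i\<in>UNIV. x $ i)"
proof -
  have "P *v (x - P *v x) = 0"
    using projector
    by (simp add: spectral_projector_zero_def matrix_vector_mult_diff_distrib matrix_vector_mul_assoc)
  then obtain y where "x - P *v x = L *v y"
    using projector by (auto simp: spectral_projector_zero_def)
  then have "(\<Sum>i\<in>UNIV. (x - P *v x) $ i) = 0"
    by (simp add: sum_generator)
  then show ?thesis
    by (simp add: sum_subtractf)
qed

lemma projector_eq: "P *v x = (\<Sum>i\<in>UNIV. x $ i) *\<^sub>R p"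
  using kernel_eq[OF generator_projector] by (simp add: sum_projector)

lemma projector_entry: "P $ i $ j = p $ i"
proof -
  have "P *v axis j 1 = p"
    unfolding projector_eq by (simp add: axis_def)
  then show ?thesis
    by (simp add: matrix_vector_mult_basis column_def vec_eq_iff)
qed

lemma resolvent_times_reduced:
  assumes "s > 0"
  shows "(mat s - L) ** reduced_resolvent L P s = mat 1 - P"
proof -
  \<comment> \<open>\<open>matrix_inv\<close> is a choice operator; invertibility for s > 0 makes it
    a genuine inverse.\<close>
  have "(mat s - L) ** matrix_inv (mat s - L) = mat 1"
    using invertible_resolvent[OF assms] someI_ex
    unfolding invertible_def matrix_inv_def by (metis (mono_tags, lifting))
  then show ?thesis
    unfolding reduced_resolvent_def by (simp add: matrix_mul_assoc)
qed

lemma reduced_resolvent_mult_vec: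
  assumes "s > 0"
  shows "s *\<^sub>R (reduced_resolvent L P s *v x) - L *v (reduced_resolvent L P s *v x) = x - P *v x"
  using arg_cong[OF resolvent_times_reduced[OF assms], of "\<lambda>M. M *v x"]
  by (simp add: mat_diff_mult_vec scalar_mult_eq_scaleR flip: matrix_vector_mul_assoc)

lemma sum_reduced_resolvent:
  assumes "s > 0"
  shows "(\<Sum>i\<in>UNIV. (reduced_resolvent L P s *v x) $ i) = 0"
proof -
  let ?y = "reduced_resolvent L P s *v x"
  have "(\<Sum>i\<in>UNIV. (s *\<^sub>R ?y - L *v ?y) $ i) = 0"
    unfolding reduced_resolvent_mult_vec[OF assms] by (simp add: sum_subtractf sum_projector)
  then show ?thesis
    using assms by (simp add: sum_subtractf sum_generator flip: sum_distrib_left)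
qed

text \<open>Each column y of R(s) is sum-zero and solves s y - L y = e_j - P e_j, whose right-hand
  side is independent of s. The uniform lower bound \<open>m\<close> thus bounds all columns at
  once.\<close>

lemma bounded_reduced_resolvent:
  obtains B where "\<And>s. 0 < s \<Longrightarrow> s \<le> d \<Longrightarrow> max_norm (reduced_resolvent L P s) \<le> B"
proof -
  obtain m where m: "m > 0" "\<And>s y. 0 \<le> s \<Longrightarrow> s \<le> d \<Longrightarrow> (\<Sum>i\<in>UNIV. y $ i) = 0 \<Longrightarrow>
      m * norm y \<le> norm (s *\<^sub>R y - L *v y)"
    using resolvent_lower_bound by metis
  define b :: "'n \<Rightarrow> real" where "b = (\<lambda>j. norm (axis j 1 - P *v axis j 1))"
  have "max_norm (reduced_resolvent L P s) \<le> (\<Sum>j\<in>UNIV. b j) / m" if "0 < s" "s \<le> d" for s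
  proof -
    let ?R = "reduced_resolvent L P s"
    have "\<bar>?R $ i $ j\<bar> \<le> (\<Sum>j\<in>UNIV. b j) / m" for i j
    proof -
      have "m * \<bar>?R $ i $ j\<bar> \<le> m * norm (?R *v axis j 1)"
        using m(1) component_le_norm_cart[of "?R *v axis j 1" i]
        by (simp add: matrix_vector_mult_basis column_def)
      also have "\<dots> \<le> b j"
        using m(2)[of s "?R *v axis j 1"] that
        by (simp add: sum_reduced_resolvent reduced_resolvent_mult_vec b_def)
      also have "\<dots> \<le> (\<Sum>j\<in>UNIV. b j)"
        by (intro member_le_sum) (auto simp: b_def)
      finally show ?thesis
        using m(1) by (simp add: field_simps)
    qed
    moreover have "{\<bar>?R $ i $ j\<bar> | i j. True} = range (\<lambda>(i, j). \<bar>?R $ i $ j\<bar>)"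
      by auto
    ultimately show ?thesis
      by (auto simp: max_norm_def)
  qed
  then show thesis
    using that by blast
qed

text \<open>Put s = 1/\<gamma>. The matrix 1 - \<gamma> L fixes the range of \<open>P\<close>,
  because L P = 0, and sends s R(s) to (s - L) R(s) = 1 - P; the two images add up to the
  identity.\<close>

lemma resolvent_split:
  assumes "\<gamma> > 0"
  shows "invertible (mat 1 - \<gamma> *\<^sub>R L)"
    and "matrix_inv (mat 1 - \<gamma> *\<^sub>R L) = P + (1 / \<gamma>) *\<^sub>R reduced_resolvent L P (1 / \<gamma>)"
proof -
  let ?A = "mat 1 - \<gamma> *\<^sub>R L" and ?R = "reduced_resolvent L P (1 / \<gamma>)"
  let ?X = "P + (1 / \<gamma>) *\<^sub>R ?R"
  have "?A *v (?X *v x) = x" for x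
  proof -
    let ?y = "?R *v x"
    have "?X *v x = P *v x + (1 / \<gamma>) *\<^sub>R ?y"
      by (simp add: matrix_vector_mult_add_rdistrib scaleR_matrix_vector_assoc)
    moreover have "?A *v w = w - \<gamma> *\<^sub>R (L *v w)" for w
      by (simp add: matrix_vector_mult_diff_rdistrib scaleR_matrix_vector_assoc)
    moreover have "L *v ((1 / \<gamma>) *\<^sub>R ?y) = (1 / \<gamma>) *\<^sub>R (L *v ?y)"
      by (rule matrix_vector_mult_scaleR)
    ultimately have "?A *v (?X *v x) = P *v x + ((1 / \<gamma>) *\<^sub>R ?y - L *v ?y)"
      using assms by (simp add: matrix_vector_right_distrib generator_projector)
    then show ?thesis
      using assms by (simp add: reduced_resolvent_mult_vec)
  qed
  then have right: "?A ** ?X = mat 1"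
    by (simp add: matrix_eq flip: matrix_vector_mul_assoc)
  then have left: "?X ** ?A = mat 1"
    by (simp add: matrix_left_right_inverse)
  show "invertible ?A"
    using right left unfolding invertible_def by blast
  show "matrix_inv ?A = ?X"
    unfolding matrix_inv_def
  proof (rule some_equality)
    fix Y assume "?A ** Y = mat 1 \<and> Y ** ?A = mat 1"
    then show "Y = ?X"
      by (metis right matrix_mul_assoc matrix_mul_lid matrix_mul_rid)
  qed (use right left in auto)
qed

end

end

end

section \<open>The threshold bound\<close>

lemma abs_entry_le_max_norm: "\<bar>M $ i $ j\<bar> \<le> max_norm M"
proof -
  have "{\<bar>M $ i $ j\<bar> | i j. True} = range (\<lambda>(i, j). \<bar>M $ i $ j\<bar>)"
    by auto
  then show ?thesis
    unfolding max_norm_def by (intro Max_ge) auto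
qed

theorem mainTheorem6:
  fixes L P :: "real^'n^'n" and p :: "real^'n" and \<delta> :: real and C :: ereal
  assumes "CARD('n) \<ge> 2"
    and "irreducible_matrix L"
    and "\<forall>j. (\<Sum>i\<in>UNIV. L $ i $ j) = 0"
    and "spectral_abscissa L = 0"
    and "simple_eigenvalue L 0"
    and "eventually_exp_pos L"
    and "stationary_density L p"
    and "spectral_projector_zero L P"
    and "\<delta> = spectral_gap L"
    and "C = (SUP s\<in>{0<..\<delta>/2}. ereal (max_norm (reduced_resolvent L P s)))"
  shows "\<delta> > 0 \<and> C < \<infinity> \<and>
         positivity_threshold L \<le> max (ereal (2 / \<delta>)) (C / ereal (Min (range (($) p))))"
proof -
  interpret eventually_positive_generator L
    using assms(3,6) by unfold_locales auto
  let ?R = "reduced_resolvent L P"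
  let ?G = "{- Re z | z. z \<in> spec L \<and> z \<noteq> 0}"
  \<comment> \<open>Membership in the set needs the minimum to be attained, hence finiteness and a
    nonzero eigenvalue.\<close>
  have "\<delta> \<in> ?G"
    unfolding assms(9) spectral_gap_def
  proof (rule Min_in)
    have "?G = (\<lambda>z. - Re z) ` (spec L - {0})"
      by auto
    then show "finite ?G"
      by (simp add: finite_spec)
    show "?G \<noteq> {}"
      using simple_eigenvalue_not_only[OF assms(5,1)] by blast
  qed
  then have \<delta>: "\<delta> > 0"
    using nonzero_eigenvalue_stable by auto
  obtain B where B: "\<And>s. 0 < s \<Longrightarrow> s \<le> \<delta> / 2 \<Longrightarrow> max_norm (?R s) \<le> B"
    using bounded_reduced_resolvent[OF assms(7,8)] by metis
  have "C \<le> ereal B"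
    unfolding assms(10) using B by (intro SUP_least) auto
  have C_ge: "ereal (max_norm (?R s)) \<le> C" if "0 < s" "s \<le> \<delta> / 2" for s
    unfolding assms(10) using that by (intro SUP_upper) auto
  \<comment> \<open>Evaluating at the end point of the interval shows that the supremum is
    nonnegative; with the bound \<open>B\<close>, the extended real \<open>C\<close> is then an
    actual real number.\<close>
  have "0 \<le> max_norm (?R (\<delta> / 2))"
    by (rule order_trans[OF abs_ge_zero abs_entry_le_max_norm])
  then have "0 \<le> C"
    using C_ge[of "\<delta> / 2"] \<delta> by (metis ereal_less_eq(5) half_gt_zero order.refl order_trans)
  then obtain c where c: "C = ereal c" "c \<ge> 0"
    using \<open>C \<le> ereal B\<close> by (cases C) auto
  define \<mu> where "\<mu> = Min (range (($) p))"
  have "\<mu> \<in> range (($) p)"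
    unfolding \<mu>_def by (intro Min_in) auto
  then have "\<mu> > 0"
    using stationary_density_pos[OF assms(7)] by auto
  have \<mu>_le: "\<mu> \<le> p $ i" for i
    unfolding \<mu>_def by (intro Min_le) auto
  define g where "g = max (2 / \<delta>) (c / \<mu>)"
  have "invertible (mat 1 - \<gamma> *\<^sub>R L) \<and> entrywise_pos (matrix_inv (mat 1 - \<gamma> *\<^sub>R L))"
    if "\<gamma> > g" for \<gamma>
  proof -
    have \<gamma>: "\<gamma> > 2 / \<delta>" "\<gamma> > c / \<mu>"
      using that by (auto simp: g_def)
    have "\<gamma> > 0"
      using \<gamma>(1) \<delta> by (smt (verit) divide_pos_pos)
    \<comment> \<open>The first term of the maximum places s = 1/\<gamma> in the interval over which
      \<open>C\<close> is the supremum.\<close>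
    have "1 / \<gamma> \<le> \<delta> / 2"
      using \<gamma>(1) \<delta> \<open>\<gamma> > 0\<close> by (simp add: field_simps)
    \<comment> \<open>The second term makes the correction s R(s) smaller than the least entry of
      \<open>P\<close>, which is \<mu> because every column of \<open>P\<close> equals
      \<open>p\<close>.\<close>
    have "c / \<gamma> < \<mu>"
      using \<gamma>(2) \<open>\<mu> > 0\<close> \<open>\<gamma> > 0\<close> by (simp add: field_simps)
    have "(P + (1 / \<gamma>) *\<^sub>R ?R (1 / \<gamma>)) $ i $ j > 0" for i j
    proof -
      have "\<bar>?R (1 / \<gamma>) $ i $ j\<bar> \<le> c"
        using abs_entry_le_max_norm[of "?R (1 / \<gamma>)" i j] C_ge[of "1 / \<gamma>"] \<open>1 / \<gamma> \<le> \<delta> / 2\<close> \<open>\<gamma> > 0\<close> c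
        by simp
      then have "- (?R (1 / \<gamma>) $ i $ j) / \<gamma> \<le> c / \<gamma>"
        using \<open>\<gamma> > 0\<close> by (intro divide_right_mono) auto
      then show ?thesis
        using \<open>c / \<gamma> < \<mu>\<close> \<mu>_le[of i] projector_entry[OF assms(7,8), of i j] by simp
    qed
    then show ?thesis
      using resolvent_split[OF assms(7,8) \<open>\<gamma> > 0\<close>] by (simp add: entrywise_pos_def)
  qed
  moreover have "0 \<le> g"
    using \<delta> by (simp add: g_def le_max_iff_disj)
  ultimately have "positivity_threshold L \<le> ereal g"
    unfolding positivity_threshold_def by (intro Inf_lower imageI) auto
  also have "ereal g = max (ereal (2 / \<delta>)) (C / ereal \<mu>)"
    using c \<open>\<mu> > 0\<close> by (simp add: g_def)
  finally show ?thesis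
    using \<delta> c by (simp add: \<mu>_def)
qed

end
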